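(* For every $T_0$ Alexandroff space $X$, there exists a topological embedding $\rho:X\to 2^{X_d}_u$. If the space $X$ is also locally finite, then the embedding is into $2^{X_d}_f$. Moreover, the embedding is as an open subset if and only if $X$ has the discrete topology.
   Context: An Alexandroff space is a topological space in which arbitrary intersections of open sets are open. A topological space is locally finite if every point has a finite neighborhood. For a topological space $X$, let $X_d$ be the underlying set of $X$ with the discrete topology. $2^{X_d}_u$ denotes the set of all non-empty subsets of $X$ with the upper semifinite topology, i.e. the topology generated by the base of sets $B(U)=\{C\subseteq X: C\neq\emptyset,\ C\subseteq U\}$, $U$ ranging over all subsets of $X$. $2^{X_d}_f\subset 2^{X_d}_u$ is the subspace of finite non-empty subsets of $X$, with the subspace topology. A topological embedding is a map that is a homeomorphism onto its image with the subspace topology; it is an embedding as an open subset if its image is open. *)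

theory Defs
  imports "HOL-Analysis.Analysis"
begin

text \<open>Intersecting with the whole space gives the empty family its intersection relative to
  the space; for nonempty families of open sets it changes nothing.\<close>
definition alexandroff_space :: "'a topology \<Rightarrow> bool" where
  "alexandroff_space X \<longleftrightarrow>
     (\<forall>\<U>. (\<forall>U\<in>\<U>. openin X U) \<longrightarrow> openin X (topspace X \<inter> \<Inter>\<U>))"

definition locally_finite_space :: "'a topology \<Rightarrow> bool" where
  "locally_finite_space X \<longleftrightarrow>
     (\<forall>x\<in>topspace X. \<exists>U N. openin X U \<and> x \<in> U \<and> U \<subseteq> N \<and> N \<subseteq> topspace X \<and> finite N)"

definition nonempty_subsets :: "'a set \<Rightarrow> 'a set set" where
  "nonempty_subsets U = {C. C \<noteq> {} \<and> C \<subseteq> U}"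

text \<open>The generating sets are closed under binary intersection,
  \<open>nonempty_subsets U \<inter> nonempty_subsets V = nonempty_subsets (U \<inter> V)\<close>,
  and cover \<open>nonempty_subsets S\<close>, so they form a base, not merely a subbase.
  Since the hyperspace is taken over the discrete space on \<open>S\<close>, only the set \<open>S\<close> is needed.\<close>
definition upper_hyperspace :: "'a set \<Rightarrow> 'a set topology" where
  "upper_hyperspace S = topology_generated_by {nonempty_subsets U |U. U \<subseteq> S}"

definition finite_upper_hyperspace :: "'a set \<Rightarrow> 'a set topology" where
  "finite_upper_hyperspace S =
     subtopology (upper_hyperspace S) {C \<in> nonempty_subsets S. finite C}"

end

theory Submission
  imports Defs
begin

text \<open>
  In an Alexandroff space every point \<open>x\<close> has a smallest open neighbourhood \<open>U\<^sub>x\<close>, and the map is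
  \<open>\<rho> x = U\<^sub>x\<close>. A set is open in \<open>X\<close> iff it contains \<open>U\<^sub>x\<close> for each of its points \<open>x\<close>; likewise
  the open sets of the upper semifinite topology are exactly the families of nonempty sets that
  are closed under passing to nonempty subsets. So both topologies consist of the
  down-sets of a preorder: \<open>y \<in> U\<^sub>x\<close>, equivalently \<open>U\<^sub>y \<subseteq> U\<^sub>x\<close>, on \<open>X\<close>, and inclusion on the
  hyperspace. The map \<open>\<rho>\<close> preserves and reflects these orders, and \<open>T\<^sub>0\<close> makes the order on \<open>X\<close>
  antisymmetric, hence \<open>\<rho>\<close> injective (\<open>inj_on_minimal_nbhd\<close>); with
  \<open>openin_upper_hyperspace_iff\<close> this gives the embedding (\<open>embedding_map_minimal_nbhd\<close>). Under
  local finiteness each \<open>U\<^sub>x\<close> lies in a finite neighbourhood of \<open>x\<close>, so \<open>\<rho>\<close> has finite values.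

  If the image of \<open>\<rho>\<close> is open, it contains with \<open>U\<^sub>x\<close> its subset \<open>{x}\<close>. Thus \<open>{x} = U\<^sub>z\<close> for some
  \<open>z\<close>, so every singleton is open. Conversely, in a discrete space the image consists of the
  singletons, and a singleton has no other nonempty subset, so the
  image is closed under passing to nonempty subsets. This is \<open>openin_image_minimal_nbhd_iff\<close>.
\<close>

text \<open>For \<open>x\<close> outside the space the family on the right is empty; intersecting with \<open>topspace X\<close>
  then gives the whole space, which keeps every value an open subset of an Alexandroff space.\<close>
definition minimal_nbhd :: "'a topology \<Rightarrow> 'a \<Rightarrow> 'a set" where
  "minimal_nbhd X x = topspace X \<inter> \<Inter>{U. openin X U \<and> x \<in> U}"

lemma minimal_nbhd_self: "x \<in> topspace X \<Longrightarrow> x \<in> minimal_nbhd X x"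
  by (auto simp: minimal_nbhd_def)

lemma minimal_nbhd_subset_topspace: "minimal_nbhd X x \<subseteq> topspace X"
  by (auto simp: minimal_nbhd_def)

lemma minimal_nbhd_least: "openin X U \<Longrightarrow> x \<in> U \<Longrightarrow> minimal_nbhd X x \<subseteq> U"
  by (auto simp: minimal_nbhd_def)

lemma openin_minimal_nbhd: "alexandroff_space X \<Longrightarrow> openin X (minimal_nbhd X x)"
  by (simp add: alexandroff_space_def minimal_nbhd_def)

lemma minimal_nbhd_mono:
  assumes "alexandroff_space X" and "y \<in> minimal_nbhd X x"
  shows "minimal_nbhd X y \<subseteq> minimal_nbhd X x"
  using assms by (simp add: minimal_nbhd_least openin_minimal_nbhd)

text \<open>Two points with the same minimal neighbourhood lie in each other's minimal neighbourhood, so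
  every open set contains both or neither of them.\<close>
lemma inj_on_minimal_nbhd:
  assumes "t0_space X"
  shows "inj_on (minimal_nbhd X) (topspace X)"
proof (rule inj_onI, rule ccontr)
  fix x y
  assume xy: "x \<in> topspace X" "y \<in> topspace X"
    and eq: "minimal_nbhd X x = minimal_nbhd X y" and "x \<noteq> y"
  then obtain U where U: "openin X U" "x \<notin> U \<longleftrightarrow> y \<in> U"
    using assms unfolding t0_space_def by blast
  have "x \<in> minimal_nbhd X y" "y \<in> minimal_nbhd X x"
    using minimal_nbhd_self[OF xy(1)] minimal_nbhd_self[OF xy(2)] eq by simp_all
  then show False
    using U(2) minimal_nbhd_least[OF U(1), of x] minimal_nbhd_least[OF U(1), of y] by auto
qed

lemma finite_minimal_nbhd:
  assumes "locally_finite_space X" and "x \<in> topspace X"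
  shows "finite (minimal_nbhd X x)"
proof -
  obtain U N where U: "openin X U" "x \<in> U" and N: "U \<subseteq> N" "finite N"
    using assms unfolding locally_finite_space_def by metis
  have "minimal_nbhd X x \<subseteq> N"
    using minimal_nbhd_least[OF U] N(1) by (rule subset_trans)
  then show ?thesis
    using N(2) by (rule finite_subset)
qed

lemma minimal_nbhd_in_nonempty_subsets_iff:
  assumes "x \<in> topspace X"
  shows "minimal_nbhd X x \<in> nonempty_subsets U \<longleftrightarrow> minimal_nbhd X x \<subseteq> U"
  using minimal_nbhd_self[OF assms] by (auto simp: nonempty_subsets_def)

lemma topspace_upper_hyperspace: "topspace (upper_hyperspace S) = nonempty_subsets S"
  unfolding upper_hyperspace_def topology_generated_by_topspace
  by (auto simp: nonempty_subsets_def)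

lemma openin_upper_hyperspace_basic: "U \<subseteq> S \<Longrightarrow> openin (upper_hyperspace S) (nonempty_subsets U)"
  unfolding upper_hyperspace_def by (rule topology_generated_by_Basis) blast

text \<open>A point \<open>C\<close> of the hyperspace has the smallest open neighbourhood \<open>nonempty_subsets C\<close>. Thus
  the hyperspace is Alexandroff too, with inclusion as its order.\<close>
lemma openin_upper_hyperspace_iff:
  "openin (upper_hyperspace S) W \<longleftrightarrow>
     W \<subseteq> nonempty_subsets S \<and> (\<forall>C\<in>W. nonempty_subsets C \<subseteq> W)"
proof (intro iffI conjI)
  assume W: "openin (upper_hyperspace S) W"
  then show "W \<subseteq> nonempty_subsets S"
    using openin_subset topspace_upper_hyperspace by metis
  have "generate_topology_on {nonempty_subsets U |U. U \<subseteq> S} W"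
    using W by (simp add: upper_hyperspace_def openin_topology_generated_by_iff)
  then show "\<forall>C\<in>W. nonempty_subsets C \<subseteq> W"
  proof (induction rule: generate_topology_on.induct)
    case (Basis W)
    then show ?case
      by (auto simp: nonempty_subsets_def)
  qed blast+
next
  assume W: "W \<subseteq> nonempty_subsets S \<and> (\<forall>C\<in>W. nonempty_subsets C \<subseteq> W)"
  then have "W = (\<Union>C\<in>W. nonempty_subsets C)"
    by (auto simp: nonempty_subsets_def)
  moreover have "openin (upper_hyperspace S) (\<Union>C\<in>W. nonempty_subsets C)"
  proof (intro openin_Union ballI)
    fix V
    assume "V \<in> nonempty_subsets ` W"
    then show "openin (upper_hyperspace S) V"
      using W by (auto simp: nonempty_subsets_def[of S] intro!: openin_upper_hyperspace_basic)
  qed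
  ultimately show "openin (upper_hyperspace S) W"
    by simp
qed

text \<open>Continuity holds because \<open>y \<in> U\<^sub>x\<close> implies \<open>U\<^sub>y \<subseteq> U\<^sub>x\<close>, and openness onto the image because
  conversely \<open>U\<^sub>y \<subseteq> U\<^sub>x\<close> implies \<open>y \<in> U\<^sub>x\<close>: the trace of \<open>nonempty_subsets U\<close> on the image is the
  image of \<open>U\<close>.\<close>
lemma embedding_map_minimal_nbhd:
  assumes "t0_space X" and alex: "alexandroff_space X"
  shows "embedding_map X (upper_hyperspace (topspace X)) (minimal_nbhd X)"
proof -
  let ?H = "upper_hyperspace (topspace X)" and ?\<rho> = "minimal_nbhd X"
  have image: "?\<rho> ` topspace X \<subseteq> nonempty_subsets (topspace X)"
    by (simp add: image_subset_iff minimal_nbhd_in_nonempty_subsets_iff minimal_nbhd_subset_topspace)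
  have cont: "continuous_map X ?H ?\<rho>"
    unfolding continuous_map_def
  proof (intro conjI allI impI)
    show "?\<rho> \<in> topspace X \<rightarrow> topspace ?H"
      using image by (auto simp: topspace_upper_hyperspace)
  next
    fix W
    assume W: "openin ?H W"
    \<comment> \<open>\<open>\<rho>\<close> is monotone, so the preimage of a down-set is a down-set.\<close>
    have "?\<rho> x \<subseteq> {x \<in> topspace X. ?\<rho> x \<in> W}" if "x \<in> topspace X" "?\<rho> x \<in> W" for x
    proof
      fix y
      assume y: "y \<in> ?\<rho> x"
      then have "y \<in> topspace X"
        by (rule subsetD[OF minimal_nbhd_subset_topspace])
      moreover from this have "?\<rho> y \<in> nonempty_subsets (?\<rho> x)"
        using minimal_nbhd_mono[OF alex y] by (simp add: minimal_nbhd_in_nonempty_subsets_iff)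
      ultimately show "y \<in> {x \<in> topspace X. ?\<rho> x \<in> W}"
        using W that by (auto simp: openin_upper_hyperspace_iff)
    qed
    then show "openin X {x \<in> topspace X. ?\<rho> x \<in> W}"
      by (subst openin_subopen)
         (auto intro!: exI[of _ "?\<rho> _"] openin_minimal_nbhd[OF alex] minimal_nbhd_self)
  qed
  have op: "open_map X (subtopology ?H (?\<rho> ` topspace X)) ?\<rho>"
    unfolding open_map_def
  proof (intro allI impI)
    fix U
    assume U: "openin X U"
    then have "U \<subseteq> topspace X"
      by (rule openin_subset)
    \<comment> \<open>As \<open>x \<in> \<rho> x\<close>, the inclusion \<open>\<rho> x \<subseteq> U\<close> holds exactly when \<open>x \<in> U\<close>.\<close>
    have "?\<rho> x \<in> nonempty_subsets U \<longleftrightarrow> x \<in> U" if "x \<in> topspace X" for x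
      using that minimal_nbhd_least[OF U] minimal_nbhd_self[OF that]
      by (auto simp: minimal_nbhd_in_nonempty_subsets_iff)
    then have "?\<rho> ` U = nonempty_subsets U \<inter> ?\<rho> ` topspace X"
      using \<open>U \<subseteq> topspace X\<close> by auto
    then show "openin (subtopology ?H (?\<rho> ` topspace X)) (?\<rho> ` U)"
      using openin_upper_hyperspace_basic[OF \<open>U \<subseteq> topspace X\<close>]
      unfolding openin_subtopology by blast
  qed
  have onto: "?\<rho> ` topspace X = topspace (subtopology ?H (?\<rho> ` topspace X))"
    using image by (auto simp: topspace_upper_hyperspace)
  have "continuous_map X (subtopology ?H (?\<rho> ` topspace X)) ?\<rho>"
    using cont by (rule continuous_map_into_subtopology) simp
  then show ?thesis
    unfolding embedding_map_def
    using op onto inj_on_minimal_nbhd[OF assms(1)] by (rule bijective_open_imp_homeomorphic_map)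
qed

text \<open>An open family is closed under shrinking its members, down to singletons, so an open image
  contains every \<open>{x}\<close>; but members of the image are open in \<open>X\<close>.\<close>
lemma openin_image_minimal_nbhd_iff:
  assumes alex: "alexandroff_space X"
  shows "openin (upper_hyperspace (topspace X)) (minimal_nbhd X ` topspace X) \<longleftrightarrow>
         X = discrete_topology (topspace X)"
proof
  assume img: "openin (upper_hyperspace (topspace X)) (minimal_nbhd X ` topspace X)"
  have "openin X {x}" if x: "x \<in> topspace X" for x
  proof -
    have "{x} \<in> nonempty_subsets (minimal_nbhd X x)"
      using minimal_nbhd_self[OF x] by (auto simp: nonempty_subsets_def)
    then obtain z where "{x} = minimal_nbhd X z"
      using img x unfolding openin_upper_hyperspace_iff by blast
    then show ?thesis
      using openin_minimal_nbhd[OF alex] by metis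
  qed
  then show "X = discrete_topology (topspace X)"
    using discrete_topology_unique[of "topspace X" X] by simp
next
  assume X: "X = discrete_topology (topspace X)"
  have "minimal_nbhd X x = {x}" if x: "x \<in> topspace X" for x
  proof -
    have "openin X {x}"
      using x discrete_topology_unique[of "topspace X" X] X[symmetric] by blast
    then show ?thesis
      using minimal_nbhd_least[of X "{x}" x] minimal_nbhd_self[OF x] by blast
  qed
  then show "openin (upper_hyperspace (topspace X)) (minimal_nbhd X ` topspace X)"
    unfolding openin_upper_hyperspace_iff by (auto simp: nonempty_subsets_def subset_singleton_iff)
qed

theorem proposition12:
  fixes X :: "'a topology"
  assumes "t0_space X" and "alexandroff_space X"
  shows "\<exists>\<rho> :: 'a \<Rightarrow> 'a set.
           embedding_map X (upper_hyperspace (topspace X)) \<rho> \<and>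
           (locally_finite_space X \<longrightarrow>
              embedding_map X (finite_upper_hyperspace (topspace X)) \<rho>) \<and>
           (openin (upper_hyperspace (topspace X)) (\<rho> ` topspace X) \<longleftrightarrow>
              X = discrete_topology (topspace X))"
proof (intro exI conjI impI)
  show emb: "embedding_map X (upper_hyperspace (topspace X)) (minimal_nbhd X)"
    using assms by (rule embedding_map_minimal_nbhd)
  show "openin (upper_hyperspace (topspace X)) (minimal_nbhd X ` topspace X) \<longleftrightarrow>
        X = discrete_topology (topspace X)"
    using assms(2) by (rule openin_image_minimal_nbhd_iff)
  assume "locally_finite_space X"
  then have "minimal_nbhd X ` topspace X \<subseteq> {C \<in> nonempty_subsets (topspace X). finite C}"
    by (simp add: image_subset_iff minimal_nbhd_in_nonempty_subsets_iff
        minimal_nbhd_subset_topspace finite_minimal_nbhd)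
  then show "embedding_map X (finite_upper_hyperspace (topspace X)) (minimal_nbhd X)"
    using emb by (simp add: finite_upper_hyperspace_def embedding_map_in_subtopology)
qed

end
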